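(* For $n\ge3$, the dual $\mathcal{P}_{K_n}^\vee$ of the Laplacian simplex of the complete graph $K_n$ is unimodularly equivalent to the Laplacian simplex $\mathcal{P}_{T_n}$ of any tree $T_n$ on $n$ vertices.
   Context: The Laplacian matrix $L$ of a simple graph on $[n]$ has $L_{ii}=\deg(i)$, $L_{ij}=-1$ if $\{i,j\}$ is an edge and $0$ otherwise; the Laplacian simplex $\mathcal{P}_G$ is the convex hull in $\mathbb{R}^{n-1}$ of the rows of $L$ with its $n$-th column deleted. The dual of a full-dimensional polytope $\mathcal{P}$ containing the origin in its interior is $\{\mathbf{x}\mid\mathbf{x}\mathbf{y}^T\le1\ \forall\mathbf{y}\in\mathcal{P}\}$. Two lattice polytopes with vertices $\mathbf{v}_i$ and $\mathbf{v}'_i$ are unimodularly equivalent if there exist $U\in\mathrm{GL}_d(\mathbb{Z})$ and $\mathbf{b}\in\mathbb{Z}^d$ with $\mathbf{v}'_i=\mathbf{v}_iU+\mathbf{b}$ for all $i$ (after a suitable relabeling of vertices). *)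

theory Defs
  imports "HOL-Analysis.Analysis" "HOL-Library.Ramsey"
begin

text \<open>
  A simple graph on the vertex set \<open>{1..n}\<close> is given by its set \<open>E\<close> of edges, which are
  2-element subsets of \<open>{1..n}\<close>.  (The predicate \<open>tree\<close> of the entry Graph-Theory is not
  suitable here: it forbids directed cycles only, so an acyclically oriented triangle
  satisfies it, while the symmetric digraph of a single edge does not.)
\<close>

definition simple_graph :: "nat \<Rightarrow> nat set set \<Rightarrow> bool" where
  "simple_graph n E \<longleftrightarrow> E \<subseteq> nsets {1..n} 2"

definition complete_graph :: "nat \<Rightarrow> nat set set" where
  "complete_graph n = nsets {1..n} 2"

definition graph_connected :: "nat \<Rightarrow> nat set set \<Rightarrow> bool" where
  "graph_connected n E \<longleftrightarrow>
     n \<ge> 1 \<and> (\<forall>u\<in>{1..n}. \<forall>v\<in>{1..n}. (u, v) \<in> {(x, y). {x, y} \<in> E}\<^sup>*)"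

text \<open>A cycle is listed without repeating its first vertex; the \<open>mod\<close> closes it up.\<close>

definition graph_cycle :: "nat set set \<Rightarrow> nat list \<Rightarrow> bool" where
  "graph_cycle E vs \<longleftrightarrow> length vs \<ge> 3 \<and> distinct vs \<and>
     (\<forall>i<length vs. {vs ! i, vs ! (Suc i mod length vs)} \<in> E)"

definition tree_graph :: "nat \<Rightarrow> nat set set \<Rightarrow> bool" where
  "tree_graph n E \<longleftrightarrow>
     simple_graph n E \<and> graph_connected n E \<and> \<not> (\<exists>vs. graph_cycle E vs)"

definition graph_degree :: "nat set set \<Rightarrow> nat \<Rightarrow> nat" where
  "graph_degree E i = card {e \<in> E. i \<in> e}"

definition laplacian :: "nat set set \<Rightarrow> nat \<Rightarrow> nat \<Rightarrow> int" where
  "laplacian E i j =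
     (if i = j then int (graph_degree E i) else if {i, j} \<in> E then -1 else 0)"

text \<open>
  \<open>real ^ 'm\<close> with \<open>CARD('m) = n - 1\<close> plays the role of \<open>\<real>\<^sup>n\<^sup>-\<^sup>1\<close>.  The linear order on \<open>'m\<close>
  numbers the coordinates: \<open>coord k\<close> is the position of \<open>k\<close> among \<open>1, \<dots>, n - 1\<close>.
\<close>

definition coord :: "'m::{finite,linorder} \<Rightarrow> nat" where
  "coord k = card {..k}"

lemma bij_betw_coord:
  "bij_betw (coord :: 'm::{finite,linorder} \<Rightarrow> nat) UNIV {1..CARD('m)}"
proof -
  have "strict_mono (coord :: 'm \<Rightarrow> nat)"
    unfolding coord_def by (intro strict_monoI psubset_card_mono) auto
  then have inj: "inj (coord :: 'm \<Rightarrow> nat)"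
    by (rule strict_mono_imp_inj_on)
  have sub: "range (coord :: 'm \<Rightarrow> nat) \<subseteq> {1..CARD('m)}"
    by (auto simp: coord_def Suc_le_eq card_gt_0_iff intro!: card_mono)
  have "range (coord :: 'm \<Rightarrow> nat) = {1..CARD('m)}"
    using card_image[OF inj] by (intro card_subset_eq sub) auto
  with inj show ?thesis
    by (simp add: bij_betw_def)
qed

text \<open>
  The columns \<open>1, \<dots>, n - 1\<close> of the Laplacian matrix are exactly the values of \<open>coord\<close>, so
  the \<open>n\<close>-th column is the one that is left out.
\<close>

definition laplacian_row :: "nat set set \<Rightarrow> nat \<Rightarrow> real ^ 'm::{finite,linorder}" where
  "laplacian_row E i = (\<chi> k. of_int (laplacian E i (coord k)))"

definition laplacian_simplex ::
    "nat \<Rightarrow> nat set set \<Rightarrow> (real ^ 'm::{finite,linorder}) set" where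
  "laplacian_simplex n E = convex hull (laplacian_row E ` {1..n})"

definition dual_polytope :: "(real ^ 'm::finite) set \<Rightarrow> (real ^ 'm) set" where
  "dual_polytope P = {x. \<forall>y\<in>P. x \<bullet> y \<le> 1}"

definition lattice_polytope :: "(real ^ 'm::finite) set \<Rightarrow> bool" where
  "lattice_polytope P \<longleftrightarrow>
     (\<exists>V. finite V \<and> (\<forall>v\<in>V. \<forall>k. v $ k \<in> \<int>) \<and> P = convex hull V)"

definition vertices :: "(real ^ 'm::finite) set \<Rightarrow> (real ^ 'm) set" where
  "vertices P = {v. v extreme_point_of P}"

text \<open>
  \<open>invertible U\<close> for an integer matrix \<open>U\<close> asks for an integer inverse, i.e. \<open>U\<close> lies in the
  general linear group over the integers.  The bijection is the relabeling of the vertices.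
\<close>

definition unimodularly_equivalent ::
    "(real ^ 'm::finite) set \<Rightarrow> (real ^ 'm) set \<Rightarrow> bool" where
  "unimodularly_equivalent P Q \<longleftrightarrow>
     lattice_polytope P \<and> lattice_polytope Q \<and>
     (\<exists>(U :: int ^ 'm ^ 'm) (b :: int ^ 'm). invertible U \<and>
        bij_betw (\<lambda>v. v v* map_matrix of_int U + (\<chi> k. of_int (b $ k)))
          (vertices P) (vertices Q))"

end

theory Submission
  imports Defs
begin

text \<open>
  The dual of the simplex of \<open>K\<^sub>n\<close> has the vertices \<open>-e\<^sub>1, \<dots>, -e\<^sub>n\<^sub>-\<^sub>1\<close> and \<open>(1, \<dots>, 1)\<close>.  If \<open>M\<close> is
  the Laplacian of the tree without its last row and column, then \<open>-M\<close> maps them to the \<open>n\<close>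
  rows of the tree's Laplacian, because these rows add up to zero.  So it remains to see that \<open>M\<close>
  is invertible over the integers.  Each edge \<open>{u, v}\<close> of a tree is a bridge, which puts
  \<open>e\<^sub>u - e\<^sub>v\<close> into the integer span of the Laplacian rows; along paths to \<open>n\<close> this yields every
  \<open>e\<^sub>i - e\<^sub>n\<close>, that is, every unit vector once the last column is deleted.
\<close>

section \<open>Paths and bridges in acyclic graphs\<close>

text \<open>A walk is extended step by step and shortcut whenever it returns to a vertex already
  visited.\<close>

lemma rtrancl_distinct_path:
  assumes "(u, v) \<in> R\<^sup>*"
  obtains vs where "vs \<noteq> []" "distinct vs" "hd vs = u" "last vs = v"
    "successively (\<lambda>x y. (x, y) \<in> R) vs"
proof -
  from assms have "\<exists>vs. vs \<noteq> [] \<and> distinct vs \<and> hd vs = u \<and> last vs = v \<and>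
    successively (\<lambda>x y. (x, y) \<in> R) vs"
  proof (induction rule: rtrancl_induct)
    case base
    show ?case by (intro exI[of _ "[u]"]) auto
  next
    case (step y z)
    then obtain vs where vs: "vs \<noteq> []" "distinct vs" "hd vs = u" "last vs = y"
      "successively (\<lambda>x y. (x, y) \<in> R) vs" by blast
    show ?case
    proof (cases "z \<in> set vs")
      case True
      \<comment> \<open>The loop at \<open>z\<close> is cut off by keeping only the path up to
        \<open>z\<close>.\<close>
      then obtain ys zs where "vs = ys @ z # zs" by (auto simp: in_set_conv_decomp)
      with vs show ?thesis
        by (intro exI[of _ "ys @ [z]"]) (auto simp: successively_append_iff hd_append)
    next
      case False
      with vs step.hyps(2) show ?thesis
        by (intro exI[of _ "vs @ [z]"]) (auto simp: successively_append_iff)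
    qed
  qed
  with that show ?thesis by blast
qed

text \<open>A simple path from \<open>u\<close> to \<open>v\<close> that avoids the edge between
  them would be closed up to a cycle by that edge.\<close>

lemma acyclic_edge_is_bridge:
  assumes "\<not> (\<exists>vs. graph_cycle E vs)" "{u, v} \<in> E" "u \<noteq> v"
  shows "(u, v) \<notin> {(x, y). {x, y} \<in> E - {{u, v}}}\<^sup>*"
proof
  assume "(u, v) \<in> {(x, y). {x, y} \<in> E - {{u, v}}}\<^sup>*"
  then obtain vs where vs: "vs \<noteq> []" "distinct vs" "hd vs = u" "last vs = v"
    "successively (\<lambda>x y. (x, y) \<in> {(x, y). {x, y} \<in> E - {{u, v}}}) vs"
    by (rule rtrancl_distinct_path)
  \<comment> \<open>Length 1 would force \<open>u = v\<close>; length 2 would use the removed edge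
    itself.\<close>
  have "length vs \<noteq> 1"
    using vs assms(3) by (auto simp: length_Suc_conv)
  moreover have "length vs \<noteq> 2"
    using vs by (auto simp: length_Suc_conv numeral_2_eq_2)
  moreover have "length vs \<noteq> 0"
    using vs by auto
  ultimately have len: "length vs \<ge> 3" by linarith
  have "{vs ! i, vs ! (Suc i mod length vs)} \<in> E" if "i < length vs" for i
  proof (cases "Suc i < length vs")
    case True
    with vs(5) show ?thesis by (auto simp: successively_conv_nth)
  next
    case False
    \<comment> \<open>Here the index wraps around, and the pair is the removed edge, run from
      \<open>v\<close> back to \<open>u\<close>.\<close>
    with that have i: "i = length vs - 1" by simp
    have "vs ! i = v" "vs ! 0 = u"
      using vs i by (auto simp: last_conv_nth hd_conv_nth)
    moreover have "Suc i = length vs"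
      using i len by simp
    then have "Suc i mod length vs = 0"
      by simp
    ultimately show ?thesis using assms(2) by (simp add: insert_commute)
  qed
  with vs len have "graph_cycle E vs" by (auto simp: graph_cycle_def)
  with assms(1) show False by blast
qed

section \<open>Sums of Laplacian rows and the lattice they span\<close>

lemma simple_graph_edgeD:
  assumes "simple_graph n E" "{u, v} \<in> E"
  shows "u \<in> {1..n}" "v \<in> {1..n}" "u \<noteq> v"
  using assms by (auto simp: simple_graph_def nsets_def card_insert_if split: if_splits)

lemma graph_degree_eq_card_neighbours:
  assumes "simple_graph n E"
  shows "graph_degree E j = card {w. {j, w} \<in> E}"
proof -
  have "bij_betw (\<lambda>w. {j, w}) {w. {j, w} \<in> E} {e \<in> E. j \<in> e}"
  proof (rule bij_betwI')
    fix e assume e: "e \<in> {e \<in> E. j \<in> e}"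
    with assms have "card e = 2" by (auto simp: simple_graph_def nsets_def)
    with e obtain w where "e = {j, w}" by (auto simp: card_2_iff insert_commute)
    with e show "\<exists>w\<in>{w. {j, w} \<in> E}. e = {j, w}" by blast
  qed (auto simp: doubleton_eq_iff)
  then show ?thesis by (simp add: graph_degree_def bij_betw_same_card)
qed

text \<open>If \<open>j\<close> lies in \<open>C\<close>, the diagonal entry counts all edges at
  \<open>j\<close> and the entries -1 cancel those inside \<open>C\<close>, so the edges leaving
  \<open>C\<close> remain. Otherwise only entries -1 occur.\<close>

lemma sum_laplacian:
  assumes "simple_graph n E" "C \<subseteq> {1..n}"
  shows "(\<Sum>i\<in>C. laplacian E i j) =
    (if j \<in> C then int (card {w. {j, w} \<in> E \<and> w \<notin> C}) else - int (card {w \<in> C. {j, w} \<in> E}))"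
proof -
  have fin: "finite C" using assms(2) finite_subset by blast
  have no_loop: "{j} \<notin> E" using simple_graph_edgeD(3)[OF assms(1), of j j] by auto
  have "{w. {j, w} \<in> E} \<subseteq> {1..n}" using simple_graph_edgeD(2)[OF assms(1)] by blast
  then have finN: "finite {w. {j, w} \<in> E}" using finite_subset by blast
  \<comment> \<open>Used both for \<open>C\<close> itself, when it misses \<open>j\<close>, and for
    \<open>C - {j}\<close>, after the diagonal entry is split off.\<close>
  have off: "(\<Sum>i\<in>D. laplacian E i j) = - int (card {w \<in> D. {j, w} \<in> E})"
    if "finite D" "j \<notin> D" for D
  proof -
    have "(\<Sum>i\<in>D. laplacian E i j) = (\<Sum>i\<in>D. if {j, i} \<in> E then -1 else 0)"
      using that by (intro sum.cong) (auto simp: laplacian_def insert_commute)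
    also have "\<dots> = - int (card {w \<in> D. {j, w} \<in> E})"
      using that by (simp add: sum.If_cases Int_def)
    finally show ?thesis .
  qed
  show ?thesis
  proof (cases "j \<in> C")
    case True
    have "{w. {j, w} \<in> E} = {w. {j, w} \<in> E \<and> w \<notin> C} \<union> {w \<in> C - {j}. {j, w} \<in> E}"
      using no_loop by auto
    also have "card \<dots> = card {w. {j, w} \<in> E \<and> w \<notin> C} + card {w \<in> C - {j}. {j, w} \<in> E}"
      using finN fin by (intro card_Un_disjoint) auto
    finally have "card {w. {j, w} \<in> E} =
      card {w. {j, w} \<in> E \<and> w \<notin> C} + card {w \<in> C - {j}. {j, w} \<in> E}" .
    moreover have "(\<Sum>i\<in>C. laplacian E i j) =
        int (card {w. {j, w} \<in> E}) - int (card {w \<in> C - {j}. {j, w} \<in> E})"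
      using fin off[of "C - {j}"] graph_degree_eq_card_neighbours[OF assms(1), of j]
      by (simp add: sum.remove[OF fin True] laplacian_def[of E j j])
    ultimately show ?thesis using True by simp
  qed (use off fin in simp)
qed

lemma laplacian_column_sum:
  assumes "simple_graph n E"
  shows "(\<Sum>i\<in>{1..n}. laplacian E i j) = 0"
proof -
  note edge = simple_graph_edgeD(1,2)[OF assms]
  show ?thesis
  proof (cases "j \<in> {1..n}")
    case True
    have "{w. {j, w} \<in> E \<and> w \<notin> {1..n}} = {}" using edge by blast
    then show ?thesis
      unfolding sum_laplacian[OF assms subset_refl] if_P[OF True] by (simp only: card.empty of_nat_0)
  next
    case False
    then have "{w \<in> {1..n}. {j, w} \<in> E} = {}" using edge by blast
    then show ?thesis
      unfolding sum_laplacian[OF assms subset_refl] if_not_P[OF False]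
      by (simp only: card.empty of_nat_0 minus_zero)
  qed
qed

lemma laplacian_sym: "laplacian E i j = laplacian E j i"
  by (simp add: laplacian_def insert_commute)

text \<open>Deleting the bridge \<open>{u, v}\<close> leaves a component \<open>C\<close> of \<open>u\<close> whose only outgoing edge
  is \<open>{u, v}\<close>; the Laplacian rows of \<open>C\<close> therefore add up to \<open>e\<^sub>u - e\<^sub>v\<close>.\<close>

lemma edge_difference_in_row_lattice:
  assumes "simple_graph n E" "\<not> (\<exists>vs. graph_cycle E vs)" "{u, v} \<in> E"
  shows "\<exists>f :: nat \<Rightarrow> int. \<forall>j. (\<Sum>i\<in>{1..n}. f i * laplacian E i j) = of_bool (j = u) - of_bool (j = v)"
proof -
  let ?R = "{(x, y). {x, y} \<in> E - {{u, v}}}"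
  define C where "C = {w. (u, w) \<in> ?R\<^sup>*}"
  note uv = simple_graph_edgeD[OF assms(1,3)]
  have "w \<in> {1..n}" if "(u, w) \<in> ?R\<^sup>*" for w
    using that by (cases rule: rtranclE) (use uv simple_graph_edgeD[OF assms(1)] in auto)
  then have sub: "C \<subseteq> {1..n}" by (auto simp: C_def)
  have vC: "v \<notin> C" using acyclic_edge_is_bridge[OF assms(2,3) uv(3)] by (simp add: C_def)
  have uC: "u \<in> C" by (simp add: C_def)
  have bridge: "x = u \<and> y = v" if "{x, y} \<in> E" "x \<in> C" "y \<notin> C" for x y
  proof (rule ccontr)
    assume "\<not> (x = u \<and> y = v)"
    \<comment> \<open>The reversed case \<open>x = v\<close>, \<open>y = u\<close> is excluded
      because \<open>v\<close> lies outside \<open>C\<close>.\<close>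
    with that uC vC have "(x, y) \<in> ?R" by (auto simp: doubleton_eq_iff)
    with that show False by (auto simp: C_def intro: rtrancl_into_rtrancl)
  qed
  have "(\<Sum>i\<in>C. laplacian E i j) = of_bool (j = u) - of_bool (j = v)" for j
  proof (cases "j \<in> C")
    case True
    have "{w. {j, w} \<in> E \<and> w \<notin> C} = (if j = u then {v} else {})"
      using bridge True assms(3) vC by auto
    with True vC show ?thesis using sum_laplacian[OF assms(1) sub, of j] by auto
  next
    case False
    have "{w \<in> C. {j, w} \<in> E} = (if j = v then {u} else {})"
      using bridge[of _ j] False assms(3) uC by (auto simp: insert_commute)
    with False uC show ?thesis using sum_laplacian[OF assms(1) sub, of j] by auto
  qed
  moreover have "(\<Sum>i\<in>{1..n}. of_bool (i \<in> C) * laplacian E i j) = (\<Sum>i\<in>C. laplacian E i j)" for j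
    using sub by (intro sum.mono_neutral_cong_right) auto
  ultimately show ?thesis by (intro exI[of _ "\<lambda>i. of_bool (i \<in> C)"]) auto
qed

text \<open>The edge differences telescope along a path from \<open>u\<close> to \<open>v\<close>,
  and the coefficient functions add up.\<close>

lemma vertex_difference_in_row_lattice:
  assumes "tree_graph n E" "u \<in> {1..n}" "v \<in> {1..n}"
  shows "\<exists>f :: nat \<Rightarrow> int. \<forall>j. (\<Sum>i\<in>{1..n}. f i * laplacian E i j) = of_bool (j = u) - of_bool (j = v)"
proof -
  have "(u, v) \<in> {(x, y). {x, y} \<in> E}\<^sup>*"
    using assms by (auto simp: tree_graph_def graph_connected_def)
  then show ?thesis
  proof (induction rule: rtrancl_induct)
    case base
    show ?case by (intro exI[of _ "\<lambda>_. 0"]) auto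
  next
    case (step y z)
    then obtain f where f: "\<And>j. (\<Sum>i\<in>{1..n}. f i * laplacian E i j) = of_bool (j = u) - of_bool (j = y)"
      by blast
    obtain g where g: "\<And>j. (\<Sum>i\<in>{1..n}. g i * laplacian E i j) = of_bool (j = y) - of_bool (j = z)"
      using edge_difference_in_row_lattice[of n E y z] step assms(1) by (auto simp: tree_graph_def)
    show ?case
      by (intro exI[of _ "\<lambda>i. f i + g i"]) (simp only: distrib_right sum.distrib f g, simp)
  qed
qed

section \<open>Coordinates and the reduced Laplacian matrix\<close>

lemma sum_coord:
  assumes "CARD('m::{finite,linorder}) = n - 1"
  shows "(\<Sum>k\<in>(UNIV :: 'm set). F (coord k)) = (\<Sum>i\<in>{1..n - 1}. F i)"
  using sum.reindex_bij_betw[OF bij_betw_coord[where 'm = 'm], of F] assms by simp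

lemma coord_in_range:
  assumes "CARD('m::{finite,linorder}) = n - 1"
  shows "coord (k :: 'm) \<in> {1..n - 1}"
  using bij_betw_apply[OF bij_betw_coord[where 'm = 'm], of k] assms by simp

lemma ex_coord_eq:
  assumes "CARD('m::{finite,linorder}) = n - 1" "i \<in> {1..n - 1}"
  obtains k :: "'m::{finite,linorder}" where "i = coord k"
  using bij_betw_imp_surj_on[OF bij_betw_coord[where 'm = 'm]] assms by force

lemma coord_eq_iff [simp]: "coord k = coord l \<longleftrightarrow> k = (l :: 'm::{finite,linorder})"
  using bij_betw_imp_inj_on[OF bij_betw_coord[where 'm = 'm]] by (auto dest: injD)

type_synonym ('a, 'm) square_matrix = "'a ^ 'm ^ 'm"

text \<open>With \<open>CARD('m) = n - 1\<close>, this drops the row and column of vertex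
  \<open>n\<close>. By the matrix-tree theorem its determinant counts spanning trees, which is 1 for
  a tree; the invertibility proof below gives an explicit inverse instead.\<close>

definition reduced_laplacian :: "nat set set \<Rightarrow> (int, 'm::{finite,linorder}) square_matrix" where
  "reduced_laplacian E = (\<chi> k l. laplacian E (coord k) (coord l))"

lemma sum_atLeastAtMost_last:
  fixes g :: "nat \<Rightarrow> 'a::comm_monoid_add"
  assumes "n \<ge> 1"
  shows "(\<Sum>i\<in>{1..n}. g i) = (\<Sum>i\<in>{1..n - 1}. g i) + g n"
  using assms by (cases n) auto

lemma invertible_reduced_laplacian:
  assumes "tree_graph n T" "CARD('m::{finite,linorder}) = n - 1"
  shows "invertible (reduced_laplacian T :: (int, 'm::{finite,linorder}) square_matrix)"
proof -
  let ?M = "reduced_laplacian T :: (int, 'm) square_matrix"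
  have n: "n \<ge> 1" and simple: "simple_graph n T"
    using assms(1) by (auto simp: tree_graph_def graph_connected_def)
  have "\<exists>f :: nat \<Rightarrow> int. \<forall>j. (\<Sum>i\<in>{1..n}. f i * laplacian T i j) = of_bool (j = coord k) - of_bool (j = n)"
    for k :: 'm
    using coord_in_range[OF assms(2), of k] n
    by (intro vertex_difference_in_row_lattice[OF assms(1)]) auto
  then obtain f :: "'m \<Rightarrow> nat \<Rightarrow> int" where
    f: "\<And>k j. (\<Sum>i\<in>{1..n}. f k i * laplacian T i j) = of_bool (j = coord k) - of_bool (j = n)"
    by metis
  \<comment> \<open>Since the rows sum to zero, a constant may be subtracted from all coefficients;
    taking \<open>f k n\<close> makes the coefficient of the dropped row vanish.\<close>
  define N :: "(int, 'm) square_matrix" where "N = (\<chi> k l. f k (coord l) - f k n)"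
  have "(N ** ?M) $ k $ l = mat 1 $ k $ l" for k l
  proof -
    have "(N ** ?M) $ k $ l = (\<Sum>i\<in>{1..n - 1}. (f k i - f k n) * laplacian T i (coord l))"
      by (simp add: matrix_matrix_mult_def N_def reduced_laplacian_def
          sum_coord[OF assms(2), where F = "\<lambda>i. (f k i - f k n) * laplacian T i (coord l)"])
    also have "\<dots> = (\<Sum>i\<in>{1..n}. (f k i - f k n) * laplacian T i (coord l))"
      using sum_atLeastAtMost_last[OF n, of "\<lambda>i. (f k i - f k n) * laplacian T i (coord l)"]
      by simp
    also have "\<dots> = of_bool (coord l = coord k) - of_bool (coord l = n)"
      by (simp add: left_diff_distrib sum_subtractf f[unfolded One_nat_def] sum_distrib_left[symmetric]
          laplacian_column_sum[OF simple, unfolded One_nat_def])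
    also have "\<dots> = mat 1 $ k $ l"
      using coord_in_range[OF assms(2), of l] n by (auto simp: mat_def)
    finally show ?thesis .
  qed
  then have left: "N ** ?M = mat 1" by (simp add: vec_eq_iff)
  \<comment> \<open>By symmetry of \<open>?M\<close>, the transpose of the left inverse is a right
    inverse, and the two must agree.\<close>
  have "transpose ?M = ?M"
    by (simp add: transpose_def reduced_laplacian_def vec_eq_iff laplacian_sym)
  with left have right: "?M ** transpose N = mat 1"
    by (metis matrix_transpose_mul transpose_mat)
  have "transpose N = N"
    by (metis left right matrix_mul_assoc matrix_mul_lid matrix_mul_rid)
  with left right show ?thesis by (auto simp: invertible_def)
qed

section \<open>The dual of the simplex of the complete graph\<close>

text \<open>The point at which all inequalities of the dual, except the one from row
  \<open>i\<close>, are equalities. The \<open>1\<close> is the all-ones vector.\<close>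

definition dual_vertex :: "nat \<Rightarrow> nat \<Rightarrow> (real, 'm::{finite,linorder}) vec" where
  "dual_vertex n i = (if i = n then 1 else \<chi> k. - of_bool (coord k = i))"

lemma laplacian_complete_graph:
  assumes "i \<in> {1..n}" "j \<in> {1..n}"
  shows "laplacian (complete_graph n) i j = (if i = j then int n - 1 else -1)"
proof -
  have adj: "{x, y} \<in> complete_graph n \<longleftrightarrow> x \<in> {1..n} \<and> y \<in> {1..n} \<and> x \<noteq> y" for x y
    by (auto simp: complete_graph_def)
  have "simple_graph n (complete_graph n)" by (simp add: simple_graph_def complete_graph_def)
  then have "graph_degree (complete_graph n) i = card {w. {i, w} \<in> complete_graph n}"
    by (rule graph_degree_eq_card_neighbours)
  also have "{w. {i, w} \<in> complete_graph n} = {1..n} - {i}" using assms by (auto simp: adj)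
  finally have "graph_degree (complete_graph n) i = n - 1" using assms by simp
  with assms show ?thesis by (auto simp: laplacian_def adj)
qed

text \<open>A half-space is convex, so an inequality valid on \<open>S\<close> extends to its
  hull.\<close>

lemma dual_polytope_convex_hull:
  "dual_polytope (convex hull S) = {x. \<forall>y\<in>S. x \<bullet> y \<le> 1}"
proof -
  have "convex hull S \<subseteq> {y. x \<bullet> y \<le> 1}" if "\<forall>y\<in>S. x \<bullet> y \<le> 1" for x
    using that by (intro hull_minimal convex_halfspace_le) auto
  then show ?thesis by (auto simp: dual_polytope_def intro: hull_inc)
qed

text \<open>Row \<open>i\<close> is \<open>n\<close> times the unit vector at \<open>i\<close> minus
  the all-ones vector. The indicator sum also covers \<open>i = n\<close>, where it is
  empty.\<close>

lemma inner_laplacian_row_complete_graph: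
  fixes x :: "(real, 'm::{finite,linorder}) vec"
  assumes "CARD('m) = n - 1" "i \<in> {1..n}"
  shows "x \<bullet> laplacian_row (complete_graph n) i =
    (\<Sum>k\<in>UNIV. real n * of_bool (coord k = i) * x $ k) - (\<Sum>k\<in>UNIV. x $ k)"
proof -
  have lap: "laplacian (complete_graph n) i (coord k) = int n * of_bool (coord k = i) - 1" for k :: 'm
    using assms(2) coord_in_range[OF assms(1), of k] by (subst laplacian_complete_graph) auto
  show ?thesis
    by (simp add: inner_vec_def laplacian_row_def lap sum_subtractf algebra_simps)
qed

text \<open>The slacks of the \<open>n\<close> inequalities at a point of the dual, divided by
  \<open>n\<close>, are its barycentric coordinates with respect to the claimed vertices.\<close>

lemma dual_laplacian_simplex_complete_graph:
  assumes card: "CARD('m::{finite,linorder}) = n - 1" and n: "n \<ge> 1"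
  shows "dual_polytope (laplacian_simplex n (complete_graph n) :: ((real, 'm::{finite,linorder}) vec) set) =
    convex hull (dual_vertex n ` {1..n})" (is "?D = ?H")
proof -
  have D: "?D = {x. \<forall>i\<in>{1..n}.
      (\<Sum>k\<in>UNIV. real n * of_bool (coord k = i) * x $ k) - (\<Sum>k\<in>UNIV. x $ k) \<le> 1}"
    by (auto simp: laplacian_simplex_def dual_polytope_convex_hull
        inner_laplacian_row_complete_graph[OF card] simp del: atLeastAtMost_iff)
  have row: "(\<Sum>k\<in>UNIV. real n * of_bool (coord k = coord l) * x $ k) = real n * x $ l"
    for x :: "(real, 'm) vec" and l
    by (simp add: of_bool_def if_distrib if_distribR sum.delta cong: if_cong)
  have off: "coord k \<noteq> n" for k :: 'm
    using coord_in_range[OF card, of k] n by auto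
  have range: "i = n \<or> (\<exists>l :: 'm. i = coord l)" if "i \<in> {1..n}" for i
  proof -
    have "i = n \<or> i \<in> {1..n - 1}" using that by auto
    then show ?thesis
      by (blast elim: ex_coord_eq[OF card])
  qed
  \<comment> \<open>The first inequality comes from row \<open>n\<close>, the others from the rows
    \<open>coord l\<close>.\<close>
  have D': "?D = {x. - (\<Sum>k\<in>UNIV. x $ k) \<le> 1 \<and> (\<forall>l. real n * x $ l - (\<Sum>k\<in>UNIV. x $ k) \<le> 1)}"
    (is "_ = ?D'")
  proof (intro equalityI subsetI)
    fix x assume "x \<in> ?D"
    then have x: "(\<Sum>k\<in>UNIV. real n * of_bool (coord k = i) * x $ k) - (\<Sum>k\<in>UNIV. x $ k) \<le> 1"
      if "i \<in> {1..n}" for i using that unfolding D by blast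
    have "coord l \<in> {1..n}" for l :: 'm using coord_in_range[OF card, of l] by auto
    then have "real n * x $ l - (\<Sum>k\<in>UNIV. x $ k) \<le> 1" for l
      using x[of "coord l"] unfolding row by blast
    with x[of n] n show "x \<in> ?D'" by (simp add: off)
  next
    fix x assume x: "x \<in> ?D'"
    show "x \<in> ?D" unfolding D
    proof (intro CollectI ballI)
      fix i assume "i \<in> {1..n}"
      from range[OF this]
      show "(\<Sum>k\<in>UNIV. real n * of_bool (coord k = i) * x $ k) - (\<Sum>k\<in>UNIV. x $ k) \<le> 1"
      proof
        assume "i = n"
        with x show ?thesis by (simp add: off)
      next
        assume "\<exists>l :: 'm. i = coord l"
        then obtain l :: 'm where l: "i = coord l" by blast
        show ?thesis using x unfolding l row by blast
      qed
    qed
  qed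
  show ?thesis
  proof
    have cv: "convex ?D"
    proof -
      have "?D = (\<Inter>y\<in>laplacian_simplex n (complete_graph n). {x. y \<bullet> x \<le> 1})"
        by (auto simp: dual_polytope_def inner_commute)
      then show ?thesis by (simp add: convex_INT convex_halfspace_le)
    qed
    have "dual_vertex n i \<in> ?D" if "i \<in> {1..n}" for i
      using range[OF that]
    proof
      assume "i = n"
      then show ?thesis using card n unfolding D' by (simp add: dual_vertex_def)
    next
      assume "\<exists>l :: 'm. i = coord l"
      then obtain l :: 'm where l: "i = coord l" by blast
      have "(\<Sum>k\<in>UNIV. (dual_vertex n i :: (real, 'm) vec) $ k) = -1"
        using l off[of l] by (simp add: dual_vertex_def sum_negf)
      then show ?thesis using l off[of l] unfolding D' by (simp add: dual_vertex_def)
    qed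
    then show "?H \<subseteq> ?D" by (intro hull_minimal cv) auto
  next
    show "?D \<subseteq> ?H"
    proof
      fix x assume x: "x \<in> ?D"
      define s where "s = (\<Sum>k\<in>UNIV. x $ k)"
      \<comment> \<open>The slack of inequality \<open>i\<close> over \<open>n\<close>: nonnegative
        on the dual, with total 1 because the slacks add up to
        \<open>n + n * s - n * s\<close>.\<close>
      define a where "a i = (1 + s - (\<Sum>k\<in>UNIV. real n * of_bool (coord k = i) * x $ k)) / real n" for i
      have a_n: "a n = (1 + s) / real n" by (simp add: a_def off)
      have a_coord: "a (coord l) = (1 + s - real n * x $ l) / real n" for l
        unfolding a_def row ..
      have nonneg: "a i \<ge> 0" if "i \<in> {1..n}" for i
      proof -
        from x that have "(\<Sum>k\<in>UNIV. real n * of_bool (coord k = i) * x $ k) - s \<le> 1"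
          unfolding D s_def by blast
        then show ?thesis using n by (simp add: a_def)
      qed
      have split: "(\<Sum>i\<in>{1..n}. g i) = (\<Sum>l\<in>(UNIV :: 'm set). g (coord l)) + g n"
        for g :: "nat \<Rightarrow> real"
        by (simp only: sum_atLeastAtMost_last[OF n] sum_coord[OF card])
      have "(\<Sum>l\<in>(UNIV :: 'm set). a (coord l)) = real (n - 1) * ((1 + s) / n) - s"
        using n by (simp add: a_coord diff_divide_distrib sum_subtractf card s_def)
      then have sum1: "(\<Sum>i\<in>{1..n}. a i) = 1"
        unfolding split a_n using n by (simp add: of_nat_diff field_simps)
      have "(\<Sum>i\<in>{1..n}. a i *\<^sub>R (dual_vertex n i :: (real, 'm) vec)) = x"
      proof (rule vec_eq_iff[THEN iffD2], rule allI)
        fix k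
        \<comment> \<open>Only the vertices with index \<open>coord k\<close> and \<open>n\<close>
          have a nonzero \<open>k\<close>-th entry.\<close>
        have "(\<Sum>i\<in>{1..n}. a i *\<^sub>R (dual_vertex n i :: (real, 'm) vec)) $ k =
            (\<Sum>l\<in>UNIV. - (if k = l then a (coord l) else 0)) + a n"
          unfolding sum_component split
          by (intro arg_cong2[of _ _ _ _ "(+)"] sum.cong) (auto simp: dual_vertex_def off)
        also have "\<dots> = a n - a (coord k)" by (simp add: sum_negf)
        also have "\<dots> = x $ k" using n by (simp add: a_n a_coord field_simps)
        finally show "(\<Sum>i\<in>{1..n}. a i *\<^sub>R (dual_vertex n i :: (real, 'm) vec)) $ k = x $ k" .
      qed
      moreover have "(\<Sum>i\<in>{1..n}. a i *\<^sub>R (dual_vertex n i :: (real, 'm) vec)) \<in> ?H"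
        by (intro convex_sum convex_convex_hull sum1 nonneg hull_inc) auto
      ultimately show "x \<in> ?H" by simp
    qed
  qed
qed

section \<open>The unimodular map onto the simplex of the tree\<close>

text \<open>A negative unit vector selects a row of the reduced Laplacian, the two signs cancelling.
  The all-ones vector gives minus the sum of the first \<open>n - 1\<close> rows, which is row
  \<open>n\<close>.\<close>

lemma dual_vertex_mult_reduced_laplacian:
  assumes "simple_graph n T" "CARD('m::{finite,linorder}) = n - 1" "i \<in> {1..n}"
  shows "(dual_vertex n i :: (real, 'm::{finite,linorder}) vec) v* map_matrix of_int (- reduced_laplacian T) = laplacian_row T i"
proof (rule vec_eq_iff[THEN iffD2], rule allI)
  fix l :: 'm
  have comp: "((dual_vertex n i :: (real, 'm) vec) v* map_matrix of_int (- reduced_laplacian T)) $ l =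
      (\<Sum>k\<in>UNIV. - of_int (laplacian T (coord k) (coord l)) * (dual_vertex n i :: (real, 'm) vec) $ k)"
    by (simp add: vector_matrix_mult_def map_matrix_def reduced_laplacian_def mult.commute)
  show "((dual_vertex n i :: (real, 'm) vec) v* map_matrix of_int (- reduced_laplacian T)) $ l =
      laplacian_row T i $ l"
  proof (cases "i = n")
    case True
    have "(\<Sum>k\<in>UNIV. laplacian T (coord (k :: 'm)) (coord l)) + laplacian T n (coord l) = 0"
      using laplacian_column_sum[OF assms(1), of "coord l"] sum_atLeastAtMost_last[of n "\<lambda>i. laplacian T i (coord l)"]
        sum_coord[OF assms(2), of "\<lambda>i. laplacian T i (coord l)"] assms(3) by simp
    then have "laplacian T n (coord l) = - (\<Sum>k\<in>UNIV. laplacian T (coord (k :: 'm)) (coord l))"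
      by linarith
    with True show ?thesis unfolding comp
      by (simp add: dual_vertex_def laplacian_row_def sum_negf)
  next
    case False
    then have "i \<in> {1..n - 1}" using assms(3) by auto
    then obtain m :: 'm where m: "i = coord m"
      by (rule ex_coord_eq[OF assms(2)])
    have "(\<Sum>k\<in>UNIV. - of_int (laplacian T (coord k) (coord l)) * (dual_vertex n i :: (real, 'm) vec) $ k)
      = (\<Sum>k\<in>UNIV. if k = m then real_of_int (laplacian T (coord k) (coord l)) else 0)"
      using False m by (intro sum.cong) (auto simp: dual_vertex_def)
    then show ?thesis unfolding comp using m by (simp add: laplacian_row_def)
  qed
qed

theorem theorem4p8:
  fixes n :: nat and T :: "nat set set"
  assumes "n \<ge> 3"
    and "CARD('m::{finite,linorder}) = n - 1"
    and "tree_graph n T"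
  shows "unimodularly_equivalent
           (dual_polytope (laplacian_simplex n (complete_graph n) :: (real ^ 'm::{finite,linorder}) set))
           (laplacian_simplex n T)"
proof -
  let ?P = "dual_polytope (laplacian_simplex n (complete_graph n)) :: ((real, 'm) vec) set"
  let ?Q = "laplacian_simplex n T :: ((real, 'm) vec) set"
  define U :: "(int, 'm) square_matrix" where "U = - reduced_laplacian T"
  define h where "h = (\<lambda>v :: (real, 'm) vec. v v* map_matrix of_int U)"
  have P: "?P = convex hull (dual_vertex n ` {1..n})"
    using dual_laplacian_simplex_complete_graph[OF assms(2)] assms(1) by simp
  have simple: "simple_graph n T" using assms(3) by (simp add: tree_graph_def)
  obtain N where N: "reduced_laplacian T ** N = (mat 1 :: (int, 'm) square_matrix)"
      "N ** reduced_laplacian T = mat 1"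
    using invertible_reduced_laplacian[OF assms(3,2)] by (auto simp: invertible_def)
  have UN: "U ** (- N) = mat 1" "(- N) ** U = mat 1"
    using N by (simp_all add: U_def matrix_matrix_mult_def vec_eq_iff)
  have linear: "linear h"
    unfolding h_def transpose_matrix_vector[symmetric] by (rule matrix_vector_mul_linear)
  have map_mult: "map_matrix real_of_int A ** map_matrix real_of_int B = map_matrix real_of_int (A ** B)"
    for A B :: "(int, 'm) square_matrix"
    by (simp add: matrix_matrix_mult_def map_matrix_def vec_eq_iff)
  have "map_matrix real_of_int (mat 1 :: (int, 'm) square_matrix) = mat 1"
    by (simp add: map_matrix_def mat_def vec_eq_iff)
  \<comment> \<open>The integer inverse, read over the reals, undoes \<open>h\<close>; this gives
    injectivity.\<close>
  then have "h v v* map_matrix real_of_int (- N) = v" for v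
    by (simp add: h_def vector_matrix_mul_assoc map_mult UN)
  then have inj: "inj h" by (metis injI)
  have Q: "?Q = h ` ?P"
  proof -
    have "laplacian_row T ` {1..n} = h ` dual_vertex n ` {1..n}"
      unfolding image_image h_def U_def
      by (intro image_cong refl dual_vertex_mult_reduced_laplacian[OF simple assms(2), symmetric])
    then show ?thesis
      by (simp only: laplacian_simplex_def[of n T] P convex_hull_linear_image[OF linear])
  qed
  \<comment> \<open>An injective linear map carries open segments to open segments, hence extreme
    points to extreme points.\<close>
  have "vertices ?Q = h ` vertices ?P"
    by (auto simp: Q vertices_def extreme_point_of_def open_segment_linear_image[OF linear inj]
        inj_image_mem_iff[OF inj] inj_eq[OF inj] image_iff)
  then have "bij_betw h (vertices ?P) (vertices ?Q)"
    using inj by (auto simp: bij_betw_def intro: inj_on_subset)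
  moreover have "h = (\<lambda>v. v v* map_matrix of_int U + (\<chi> k. of_int ((0 :: (int, 'm) vec) $ k)))"
    by (simp add: h_def fun_eq_iff vec_eq_iff)
  moreover have "invertible U" using UN by (auto simp: invertible_def)
  moreover have "lattice_polytope ?P"
    unfolding lattice_polytope_def P
    by (intro exI[of _ "dual_vertex n ` {1..n}"]) (auto simp: dual_vertex_def)
  moreover have "lattice_polytope ?Q"
    unfolding lattice_polytope_def laplacian_simplex_def
    by (intro exI[of _ "laplacian_row T ` {1..n}"]) (auto simp: laplacian_row_def)
  ultimately show ?thesis unfolding unimodularly_equivalent_def by metis
qed

end
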